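(* (Pfaffian Cayley–Hamilton Theorem) Let $n\ge1$, let $A$ be a $2n\times 2n$ skew-symmetric matrix with Pfaffian coefficients $q_n^A,q_{n-1}^A,\ldots,q_0^A$, and let $\Phi_A(x)=q^A_nx^n+q^A_{n-1}x^{n-1}+\cdots+q^A_0$. Then, with $J=J_n$, $$\Phi_A(AJ)=q^A_n(AJ)^n+q^A_{n-1}(AJ)^{n-1}+\cdots+q^A_0I=0 .$$
   Context: Matrices have entries in a commutative ring with $1$; skew-symmetric means $a_{ji}=-a_{ij}$ and $a_{ii}=0$. $J_1=\begin{pmatrix}0&1\\-1&0\end{pmatrix}$ and $J_m$ is the $2m\times 2m$ block diagonal matrix with $m$ diagonal blocks $J_1$. **Pfaffian coefficients (PB algorithm).** For a $2n\times2n$ skew-symmetric $A=(a_{ij})$ the sequence $\vec q_A=(q^A_n,q^A_{n-1},\ldots,q^A_0)$ is defined recursively. If $n=1$, $\vec q_A=(1,a_{12})$. If $n\ge 2$, write $$A=\begin{pmatrix}0&a_{12}&R\\-a_{12}&0&-{}^tS\\-{}^tR&S&M\end{pmatrix}$$ with $R$ a row vector and $S$ a column vector of length $2n-2$, and $M$ skew-symmetric of size $(2n-2)\times(2n-2)$. Put $t_i=0$ for $i<0$, $t_0=1$, $t_1=a_{12}$, $t_i=RJ_{n-1}(MJ_{n-1})^{i-2}S$ for $i\ge 2$. Let $P_A$ be the $(n+1)\times n$ matrix with $(r,c)$ entry $t_{r-c}$. Then (as column vectors) $\vec q_A=P_A\,\vec q_M$. *)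

theory Defs
  imports
    "Jordan_Normal_Form.Matrix"
    "HOL-Computational_Algebra.Polynomial"
begin

definition skew_symmetric_mat :: "nat \<Rightarrow> 'a :: comm_ring_1 mat \<Rightarrow> bool" where
  "skew_symmetric_mat m A \<longleftrightarrow> A \<in> carrier_mat m m \<and>
     (\<forall>i<m. \<forall>j<m. A $$ (j, i) = - A $$ (i, j)) \<and> (\<forall>i<m. A $$ (i, i) = 0)"

definition J1_mat :: "'a :: comm_ring_1 mat" where
  "J1_mat = mat_of_rows_list 2 [[0, 1], [- 1, 0]]"

definition J_mat :: "nat \<Rightarrow> 'a :: comm_ring_1 mat" where
  "J_mat m = diag_block_mat (replicate m J1_mat)"

(* The blocks R, S, M of a 2n x 2n matrix; entries are indexed from 0, so a_12 is A $$ (0, 1),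
   R is the rest of the first row and S is the rest of the second column. *)

definition pf_R :: "nat \<Rightarrow> 'a :: comm_ring_1 mat \<Rightarrow> 'a vec" where
  "pf_R n A = vec (2 * n - 2) (\<lambda>j. A $$ (0, j + 2))"

definition pf_S :: "nat \<Rightarrow> 'a :: comm_ring_1 mat \<Rightarrow> 'a vec" where
  "pf_S n A = vec (2 * n - 2) (\<lambda>i. A $$ (i + 2, 1))"

definition pf_M :: "nat \<Rightarrow> 'a :: comm_ring_1 mat \<Rightarrow> 'a mat" where
  "pf_M n A = mat (2 * n - 2) (2 * n - 2) (\<lambda>(i, j). A $$ (i + 2, j + 2))"

definition pf_t :: "nat \<Rightarrow> 'a :: comm_ring_1 mat \<Rightarrow> int \<Rightarrow> 'a" where
  "pf_t n A i =
     (if i < 0 then 0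
      else if i = 0 then 1
      else if i = 1 then A $$ (0, 1)
      else pf_R n A \<bullet>
        ((J_mat (n - 1) * (pf_M n A * J_mat (n - 1)) ^\<^sub>m nat (i - 2)) *\<^sub>v pf_S n A))"

definition pf_P :: "nat \<Rightarrow> 'a :: comm_ring_1 mat \<Rightarrow> 'a mat" where
  "pf_P n A = mat (n + 1) n (\<lambda>(r, c). pf_t n A (int r - int c))"

(* The vector (q_n, ..., q_0) of a 2n x 2n matrix. The recursion starts at n = 1;
   the value for n = 0 is a convention and is never reached from n >= 1. *)
fun pf_coeffs :: "nat \<Rightarrow> 'a :: comm_ring_1 mat \<Rightarrow> 'a vec" where
  "pf_coeffs 0 A = vec_of_list [1]"
| "pf_coeffs (Suc 0) A = vec_of_list [1, A $$ (0, 1)]"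
| "pf_coeffs (Suc (Suc k)) A =
     pf_P (Suc (Suc k)) A *\<^sub>v pf_coeffs (Suc k) (pf_M (Suc (Suc k)) A)"

(* The vector lists q_n first, so q_k sits at position n - k. *)
definition pf_coeff :: "nat \<Rightarrow> 'a :: comm_ring_1 mat \<Rightarrow> nat \<Rightarrow> 'a" where
  "pf_coeff n A k = pf_coeffs n A $ (n - k)"

definition pf_poly :: "nat \<Rightarrow> 'a :: comm_ring_1 mat \<Rightarrow> 'a poly" where
  "pf_poly n A = (\<Sum>k\<le>n. monom (pf_coeff n A k) k)"

(* Evaluation of a polynomial at an N x N matrix; sums of matrices are taken in the module
   of N x N matrices since the type of all matrices has no global zero. *)
definition poly_at_mat :: "nat \<Rightarrow> 'a :: comm_ring_1 poly \<Rightarrow> 'a mat \<Rightarrow> 'a mat" where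
  "poly_at_mat N p X =
     finsum (module_mat TYPE('a) N N) (\<lambda>k. coeff p k \<cdot>\<^sub>m (X ^\<^sub>m k)) {..degree p}"

end

theory Submission
  imports Defs "HOL-Computational_Algebra.Formal_Power_Series"
begin

text \<open>
  Let \<open>B = A J\<close>, let \<open>g\<^sub>i\<^sub>j\<close> be the entries of \<open>(1 - X B)\<close> inverse, as power series in \<open>X\<close>, and
  let \<open>F\<close> be the reversed polynomial \<open>q\<^sub>n + q\<^sub>n\<^sub>-\<^sub>1 X + \<dots>\<close>. Since the coefficient of \<open>X\<^sup>n\<close> in \<open>F g\<^sub>i\<^sub>j\<close>
  is the entry \<open>(i, j)\<close> of \<open>\<Phi>(B)\<close>, it suffices that every \<open>F g\<^sub>i\<^sub>j\<close> has degree less than \<open>n\<close>.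
  The matrices \<open>J B\<^sup>k\<close> are skew-symmetric, so the Schur complement of the first diagonal pair is
  scalar and the series with coefficients \<open>t\<^sub>i\<close> is the inverse of the entry \<open>g\<close> at \<open>(0, 0)\<close>.
  Given the theorem for \<open>M\<close>, the recursion thus says that \<open>F\<close> times this entry is the series of \<open>M\<close>.
  By skew-symmetry the product of two successive such entries does not depend on the order in
  which two pairs are deleted; so \<open>F\<close> times the diagonal entry of any pair is the series of \<open>A\<close>
  with that pair deleted, and all columns of \<open>F g\<close> are controlled by the induction hypothesis.
\<close>

section \<open>Resolvents\<close>

text \<open>Entry of the geometric series G = 1 + X B + X^2 B^2 + ..., the inverse of 1 - X B.
  Working entry by entry keeps all calculations in the commutative ring of scalar power
  series.\<close>

definition resolvent :: "'a :: comm_ring_1 mat \<Rightarrow> nat \<Rightarrow> nat \<Rightarrow> 'a fps" where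
  "resolvent B i j = Abs_fps (\<lambda>k. (B ^\<^sub>m k) $$ (i, j))"

lemma mult_mat_index_sum:
  assumes "A \<in> carrier_mat k m" "B \<in> carrier_mat m l" "i < k" "j < l"
  shows "(A * B) $$ (i, j) = (\<Sum>r<m. A $$ (i, r) * B $$ (r, j))"
  using assms by (simp add: scalar_prod_def lessThan_atLeast0)

lemma pow_mat_Suc_left:
  assumes "B \<in> carrier_mat m m"
  shows "B ^\<^sub>m Suc k = B * B ^\<^sub>m k"
proof (induction k)
  case 0
  then show ?case using assms by simp
next
  case (Suc k)
  have "B ^\<^sub>m Suc (Suc k) = (B * B ^\<^sub>m k) * B"
    using Suc by simp
  also have "\<dots> = B * (B ^\<^sub>m k * B)"
    using assms by (intro assoc_mult_mat) auto
  finally show ?case by simp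
qed

text \<open>Entrywise form of G = 1 + X B G, from \<open>B^(k+1) = B B^k\<close>; the mirrored
  factorization gives \<open>resolvent_right\<close>.\<close>

lemma resolvent_left:
  assumes "B \<in> carrier_mat m m" "i < m" "j < m"
  shows "resolvent B i j = of_bool (i = j) + fps_X * (\<Sum>l<m. fps_const (B $$ (i, l)) * resolvent B l j)"
proof (rule fps_ext)
  fix k
  show "fps_nth (resolvent B i j) k =
      fps_nth (of_bool (i = j) + fps_X * (\<Sum>l<m. fps_const (B $$ (i, l)) * resolvent B l j)) k"
  proof (cases k)
    case 0
    then show ?thesis using assms by (simp add: resolvent_def)
  next
    case (Suc k')
    have "(B ^\<^sub>m Suc k') $$ (i, j) = (\<Sum>l<m. B $$ (i, l) * (B ^\<^sub>m k') $$ (l, j))"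
      unfolding pow_mat_Suc_left[OF assms(1)] using assms by (intro mult_mat_index_sum) auto
    then show ?thesis using Suc by (simp add: resolvent_def fps_sum_nth)
  qed
qed

lemma resolvent_right:
  assumes "B \<in> carrier_mat m m" "i < m" "j < m"
  shows "resolvent B i j = of_bool (i = j) + fps_X * (\<Sum>l<m. resolvent B i l * fps_const (B $$ (l, j)))"
proof (rule fps_ext)
  fix k
  show "fps_nth (resolvent B i j) k =
      fps_nth (of_bool (i = j) + fps_X * (\<Sum>l<m. resolvent B i l * fps_const (B $$ (l, j)))) k"
  proof (cases k)
    case 0
    then show ?thesis using assms by (simp add: resolvent_def)
  next
    case (Suc k')
    have "(B ^\<^sub>m Suc k') $$ (i, j) = (\<Sum>l<m. (B ^\<^sub>m k') $$ (i, l) * B $$ (l, j))"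
      unfolding pow_mat.simps using assms by (intro mult_mat_index_sum) auto
    then show ?thesis using Suc by (simp add: resolvent_def fps_sum_nth)
  qed
qed

text \<open>The hypothesis says (1 - X B) h = c; multiplying by G from the left and using G X B = G
  - 1 cancels the factor. Series defined by other means can thus be identified through a fixed-point
  equation.\<close>

lemma resolvent_unique:
  fixes h c :: "nat \<Rightarrow> 'a :: comm_ring_1 fps"
  assumes B: "B \<in> carrier_mat m m"
    and h: "\<And>i. i < m \<Longrightarrow> h i = c i + fps_X * (\<Sum>l<m. fps_const (B $$ (i, l)) * h l)"
    and i: "i < m"
  shows "h i = (\<Sum>l<m. resolvent B i l * c l)"
proof -
  have "(\<Sum>l<m. resolvent B i l * c l) =
      (\<Sum>l<m. resolvent B i l * (h l - fps_X * (\<Sum>r<m. fps_const (B $$ (l, r)) * h r)))"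
    by (intro sum.cong refl arg_cong2[where f = "(*)"]) (simp add: h eq_diff_eq flip: h)
  also have "\<dots> = (\<Sum>l<m. resolvent B i l * h l) -
      (\<Sum>l<m. \<Sum>r<m. fps_X * (resolvent B i l * fps_const (B $$ (l, r))) * h r)"
    by (simp add: right_diff_distrib sum_subtractf sum_distrib_left mult_ac)
  also have "(\<Sum>l<m. \<Sum>r<m. fps_X * (resolvent B i l * fps_const (B $$ (l, r))) * h r) =
      (\<Sum>r<m. (fps_X * (\<Sum>l<m. resolvent B i l * fps_const (B $$ (l, r)))) * h r)"
    by (subst sum.swap) (simp add: sum_distrib_left sum_distrib_right)
  also have "\<dots> = (\<Sum>r<m. (resolvent B i r - of_bool (i = r)) * h r)"
    by (intro sum.cong refl arg_cong2[where f = "(*)"])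
       (simp add: resolvent_right[OF B i])
  also have "\<dots> = (\<Sum>r<m. resolvent B i r * h r) - h i"
    using i by (simp add: left_diff_distrib sum_subtractf of_bool_def if_distrib[of "\<lambda>x. x * _"] cong: if_cong)
  finally show ?thesis by simp
qed

section \<open>Deleting a pair of indices\<close>

text \<open>Order-preserving enumeration of the indices outside the pair {2p, 2p+1}. Dropping a
  whole pair preserves parity, hence the pairing encoded by J.\<close>

definition del_index :: "nat \<Rightarrow> nat \<Rightarrow> nat" where
  "del_index p i = (if i < 2 * p then i else i + 2)"

definition del_pair :: "nat \<Rightarrow> 'a mat \<Rightarrow> 'a mat" where
  "del_pair p A = mat (dim_row A - 2) (dim_col A - 2)
     (\<lambda>(i, j). A $$ (del_index p i, del_index p j))"

lemma del_pair_carrier [simp]: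
  "A \<in> carrier_mat (m + 2) (m + 2) \<Longrightarrow> del_pair p A \<in> carrier_mat m m"
  by (auto simp: del_pair_def)

lemma del_pair_index:
  assumes "A \<in> carrier_mat (m + 2) (m + 2)" "i < m" "j < m"
  shows "del_pair p A $$ (i, j) = A $$ (del_index p i, del_index p j)"
  using assms by (auto simp: del_pair_def)

lemma del_index_less: "i < m \<Longrightarrow> del_index p i < m + 2"
  by (simp add: del_index_def)

lemma del_index_eq_iff [simp]: "del_index p i = del_index p j \<longleftrightarrow> i = j"
  by (auto simp: del_index_def)

lemma del_index_neq [simp]: "del_index p i \<noteq> 2 * p" "del_index p i \<noteq> Suc (2 * p)"
  by (auto simp: del_index_def)

lemma lessThan_del_index:
  assumes "2 * p \<le> m"
  shows "{..<m + 2} = insert (2 * p) (insert (2 * p + 1) (del_index p ` {..<m}))"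
proof (intro equalityI subsetI)
  fix x assume x: "x \<in> {..<m + 2}"
  consider "x < 2 * p" | "x = 2 * p" | "x = 2 * p + 1" | "x \<ge> 2 * p + 2" by linarith
  then show "x \<in> insert (2 * p) (insert (2 * p + 1) (del_index p ` {..<m}))"
  proof cases
    case 1
    then have "x = del_index p x" by (simp add: del_index_def)
    then show ?thesis using 1 assms by auto
  next
    case 4
    then have "x = del_index p (x - 2)" "x - 2 < m" using x by (auto simp: del_index_def)
    then show ?thesis by blast
  qed auto
qed (use assms in \<open>auto simp: del_index_def\<close>)

lemma sum_del_index:
  fixes f :: "nat \<Rightarrow> 'b :: comm_monoid_add"
  assumes "2 * p \<le> m"
  shows "(\<Sum>l<m + 2. f l) = f (2 * p) + f (2 * p + 1) + (\<Sum>l<m. f (del_index p l))"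
proof -
  have "2 * p \<notin> insert (2 * p + 1) (del_index p ` {..<m})" "2 * p + 1 \<notin> del_index p ` {..<m}"
    by (auto simp: del_index_def)
  then have "(\<Sum>l<m + 2. f l) = f (2 * p) + f (2 * p + 1) + sum f (del_index p ` {..<m})"
    unfolding lessThan_del_index[OF assms] by (simp add: add.assoc)
  moreover have "sum f (del_index p ` {..<m}) = (\<Sum>l<m. f (del_index p l))"
    by (subst sum.reindex) (auto simp: inj_on_def)
  ultimately show ?thesis by simp
qed

text \<open>The last three assumptions make the diagonal 2 x 2 block of the resolvent at the pair a
  scalar matrix, so the pair can be eliminated as if it were a single index.\<close>

locale resolvent_pair =
  fixes m p :: nat and B :: "'a :: comm_ring_1 mat"
  assumes carrier: "B \<in> carrier_mat (m + 2) (m + 2)" and pair_le: "2 * p \<le> m"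
    and upper_zero: "resolvent B (2 * p) (2 * p + 1) = 0"
    and lower_zero: "resolvent B (2 * p + 1) (2 * p) = 0"
    and diag_eq: "resolvent B (2 * p + 1) (2 * p + 1) = resolvent B (2 * p) (2 * p)"
begin

text \<open>Separating the contributions of the pair in G = 1 + X B G leaves a fixed-point equation
  for \<open>del_pair p B\<close>, the form required by \<open>resolvent_unique\<close>.\<close>

lemma left_del:
  assumes "i < m" "j < m + 2"
  shows "resolvent B (del_index p i) j = of_bool (del_index p i = j)
    + fps_X * (fps_const (B $$ (del_index p i, 2 * p)) * resolvent B (2 * p) j
        + fps_const (B $$ (del_index p i, 2 * p + 1)) * resolvent B (2 * p + 1) j)
    + fps_X * (\<Sum>l<m. fps_const (del_pair p B $$ (i, l)) * resolvent B (del_index p l) j)"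
  using assms
  by (simp only: resolvent_left[OF carrier del_index_less[OF assms(1)] assms(2)] sum_del_index[OF pair_le])
     (simp add: del_pair_index[OF carrier] algebra_simps)

text \<open>In the column of index 2p the entry at row 2p+1 vanishes, so only the diagonal entry of
  the pair drives the fixed-point equation for the remaining rows.\<close>

lemma column_even:
  assumes "i < m"
  shows "resolvent B (del_index p i) (2 * p) =
    fps_X * (\<Sum>l<m. resolvent (del_pair p B) i l *
      (fps_const (B $$ (del_index p l, 2 * p)) * resolvent B (2 * p) (2 * p)))"
proof -
  have "resolvent B (del_index p i) (2 * p) =
      (\<Sum>l<m. resolvent (del_pair p B) i l *
        (fps_X * (fps_const (B $$ (del_index p l, 2 * p)) * resolvent B (2 * p) (2 * p))))"
    by (rule resolvent_unique[OF del_pair_carrier[OF carrier] _ assms])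
       (use pair_le lower_zero in \<open>simp add: left_del\<close>)
  then show ?thesis by (simp add: sum_distrib_left mult_ac)
qed

lemma column_odd:
  assumes "i < m"
  shows "resolvent B (del_index p i) (2 * p + 1) =
    fps_X * (\<Sum>l<m. resolvent (del_pair p B) i l *
      (fps_const (B $$ (del_index p l, 2 * p + 1)) * resolvent B (2 * p) (2 * p)))"
proof -
  have "resolvent B (del_index p i) (2 * p + 1) =
      (\<Sum>l<m. resolvent (del_pair p B) i l *
        (fps_X * (fps_const (B $$ (del_index p l, 2 * p + 1)) * resolvent B (2 * p) (2 * p))))"
    by (rule resolvent_unique[OF del_pair_carrier[OF carrier] _ assms])
       (use pair_le upper_zero diag_eq in \<open>simp add: left_del\<close>)
  then show ?thesis by (simp add: sum_distrib_left mult_ac)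
qed

text \<open>Schur complement formula for the inverse, multiplied by the diagonal entry of the pair
  to avoid division.\<close>

lemma resolvent_del_pair:
  assumes "i < m" "j < m"
  shows "resolvent B (2 * p) (2 * p) * resolvent (del_pair p B) i j =
    resolvent B (2 * p) (2 * p) * resolvent B (del_index p i) (del_index p j)
    - resolvent B (del_index p i) (2 * p) * resolvent B (2 * p) (del_index p j)
    - resolvent B (del_index p i) (2 * p + 1) * resolvent B (2 * p + 1) (del_index p j)"
proof -
  let ?a = "2 * p" and ?b = "2 * p + 1" and ?d = "del_index p"
  let ?g = "resolvent B"
  \<comment> \<open>Here j is fixed. The two subtracted products are chosen to cancel the
    contributions of the pair in \<open>left_del\<close>, so w solves the fixed-point equation of
    \<open>del_pair p B\<close>.\<close>
  define w where "w i = ?g ?a ?a * ?g (?d i) (?d j) - ?g (?d i) ?a * ?g ?a (?d j)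
    - ?g (?d i) ?b * ?g ?b (?d j)" for i
  have w: "w i = ?g ?a ?a * of_bool (i = j) +
      fps_X * (\<Sum>l<m. fps_const (del_pair p B $$ (i, l)) * w l)" if i: "i < m" for i
  proof -
    let ?s = "\<lambda>j. \<Sum>l<m. fps_const (del_pair p B $$ (i, l)) * ?g (?d l) j"
    have s: "(\<Sum>l<m. fps_const (del_pair p B $$ (i, l)) * w l) =
        ?g ?a ?a * ?s (?d j) - ?s ?a * ?g ?a (?d j) - ?s ?b * ?g ?b (?d j)"
      by (simp add: w_def right_diff_distrib sum_subtractf sum_distrib_left sum_distrib_right mult_ac)
    have 1: "?g (?d i) (?d j) = of_bool (i = j) + fps_X * (fps_const (B $$ (?d i, ?a)) * ?g ?a (?d j)
        + fps_const (B $$ (?d i, ?b)) * ?g ?b (?d j)) + fps_X * ?s (?d j)"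
      using left_del[OF i del_index_less[OF assms(2)]] by simp
    have 2: "?g (?d i) ?a = fps_X * (fps_const (B $$ (?d i, ?a)) * ?g ?a ?a) + fps_X * ?s ?a"
      using left_del[OF i, of ?a] pair_le lower_zero by simp
    have 3: "?g (?d i) ?b = fps_X * (fps_const (B $$ (?d i, ?b)) * ?g ?a ?a) + fps_X * ?s ?b"
      using left_del[OF i, of ?b] pair_le upper_zero diag_eq by simp
    show ?thesis unfolding s w_def[of i] 1 2 3 by (simp add: algebra_simps)
  qed
  have "w i = (\<Sum>l<m. resolvent (del_pair p B) i l * (?g ?a ?a * of_bool (l = j)))"
    by (rule resolvent_unique[OF del_pair_carrier[OF carrier] w assms(1)])
  also have "\<dots> = ?g ?a ?a * resolvent (del_pair p B) i j"
    using assms by (simp add: of_bool_def mult_delta_left mult_delta_right mult.commute)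
  finally show ?thesis by (simp add: w_def)
qed

end

section \<open>Skew-symmetric matrices\<close>

lemma J_mat_carrier [simp]: "J_mat n \<in> carrier_mat (2 * n) (2 * n)"
proof -
  have "J_mat n = (diag_block_mat (replicate n J1_mat) :: 'a mat)" by (simp add: J_mat_def)
  moreover have "dim_row (J1_mat :: 'a mat) = 2" "dim_col (J1_mat :: 'a mat) = 2"
    by (simp_all add: J1_mat_def mat_of_rows_list_def)
  ultimately show ?thesis
    by (auto simp: dim_diag_block_mat sum_list_replicate intro!: carrier_matI)
qed

lemma J_mat_dim [simp]: "dim_row (J_mat n) = 2 * n" "dim_col (J_mat n) = 2 * n"
  by (rule carrier_matD[OF J_mat_carrier])+

lemma J_mat_index:
  assumes "i < 2 * n" "j < 2 * n"
  shows "(J_mat n :: 'a :: comm_ring_1 mat) $$ (i, j) =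
    (if even i then of_bool (j = Suc i) else - of_bool (i = Suc j))"
  using assms
proof (induction n arbitrary: i j)
  case 0
  then show ?case by simp
next
  case (Suc n)
  have J1: "dim_row (J1_mat :: 'a mat) = 2" "dim_col (J1_mat :: 'a mat) = 2"
    by (simp_all add: J1_mat_def mat_of_rows_list_def)
  have step: "J_mat (Suc n) = four_block_mat (J1_mat :: 'a mat) (0\<^sub>m 2 (2 * n)) (0\<^sub>m (2 * n) 2) (J_mat n)"
    using J1 carrier_matD[OF J_mat_carrier[of n, where 'a = 'a]] by (simp add: J_mat_def Let_def)
  have idx: "(J_mat (Suc n) :: 'a mat) $$ (i, j) =
      (if i < 2 then if j < 2 then J1_mat $$ (i, j) else 0
       else if j < 2 then 0 else J_mat n $$ (i - 2, j - 2))"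
    unfolding step using Suc.prems by (subst index_mat_four_block) (auto simp: J1)
  consider "i < 2" "j < 2" | "i < 2" "j \<ge> 2" | "i \<ge> 2" "j < 2"
    | i' j' where "i = i' + 2" "j = j' + 2"
    by (metis add.commute le_Suc_ex not_less)
  then show ?case
  proof cases
    case 1
    then have "i = 0 \<or> i = 1" "j = 0 \<or> j = 1" by auto
    then show ?thesis unfolding idx by (auto simp: J1_mat_def mat_of_rows_list_def)
  next
    case 2
    then have "i = 0 \<or> i = 1" by auto
    then show ?thesis unfolding idx using 2 by auto
  next
    case 3
    then have "j = 0 \<or> j = 1" by auto
    then show ?thesis unfolding idx using 3 by auto
  next
    case 4
    then show ?thesis unfolding idx using Suc by auto
  qed
qed

lemma mult_J_mat_index:
  fixes A :: "'a :: comm_ring_1 mat"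
  assumes "A \<in> carrier_mat k (2 * n)" "i < k" "j < 2 * n"
  shows "(A * J_mat n) $$ (i, j) = (if even j then - A $$ (i, Suc j) else A $$ (i, j - 1))"
proof -
  have eq: "(A * J_mat n) $$ (i, j) =
      (\<Sum>r<2 * n. A $$ (i, r) * (if even r then of_bool (j = Suc r) else - of_bool (r = Suc j)))"
    using assms(3) by (simp add: mult_mat_index_sum[OF assms(1) J_mat_carrier assms(2,3)] J_mat_index)
  show ?thesis
  proof (cases "even j")
    case True
    then have "Suc j < 2 * n" using assms(3) by presburger
    have "(\<Sum>r<2 * n. A $$ (i, r) * (if even r then of_bool (j = Suc r) else - of_bool (r = Suc j))) =
      (\<Sum>r<2 * n. if r = Suc j then - A $$ (i, r) else 0)"
      using True by (intro sum.cong) auto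
    then show ?thesis using True eq \<open>Suc j < 2 * n\<close> by simp
  next
    case False
    then obtain c where j: "j = Suc (2 * c)" by (auto elim: oddE)
    then have "j - 1 < 2 * n" using assms(3) by simp
    have "(\<Sum>r<2 * n. A $$ (i, r) * (if even r then of_bool (j = Suc r) else - of_bool (r = Suc j))) =
      (\<Sum>r<2 * n. if r = j - 1 then A $$ (i, r) else 0)"
      using j by (intro sum.cong) auto
    then show ?thesis using False eq \<open>j - 1 < 2 * n\<close> by simp
  qed
qed

lemma J_mat_mult_index:
  fixes A :: "'a :: comm_ring_1 mat"
  assumes "A \<in> carrier_mat (2 * n) k" "i < 2 * n" "j < k"
  shows "(J_mat n * A) $$ (i, j) = (if even i then A $$ (Suc i, j) else - A $$ (i - 1, j))"
proof -
  have eq: "(J_mat n * A) $$ (i, j) =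
      (\<Sum>r<2 * n. (if even i then of_bool (r = Suc i) else - of_bool (i = Suc r)) * A $$ (r, j))"
    using assms(2) by (simp add: mult_mat_index_sum[OF J_mat_carrier assms] J_mat_index)
  show ?thesis
  proof (cases "even i")
    case True
    then have "Suc i < 2 * n" using assms(2) by presburger
    have "(\<Sum>r<2 * n. (if even i then of_bool (r = Suc i) else - of_bool (i = Suc r)) * A $$ (r, j)) =
      (\<Sum>r<2 * n. if r = Suc i then A $$ (r, j) else 0)"
      using True by (intro sum.cong) auto
    then show ?thesis using True eq \<open>Suc i < 2 * n\<close> by simp
  next
    case False
    then obtain c where i: "i = Suc (2 * c)" by (auto elim: oddE)
    then have "i - 1 < 2 * n" using assms(2) by simp
    have "(\<Sum>r<2 * n. (if even i then of_bool (r = Suc i) else - of_bool (i = Suc r)) * A $$ (r, j)) =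
      (\<Sum>r<2 * n. if r = i - 1 then - A $$ (r, j) else 0)"
      using i by (intro sum.cong) auto
    then show ?thesis using False eq \<open>i - 1 < 2 * n\<close> by simp
  qed
qed

section \<open>Skew-symmetry and congruence\<close>

lemma skew_symmetric_matD:
  assumes "skew_symmetric_mat m A"
  shows "A \<in> carrier_mat m m" "\<And>i j. i < m \<Longrightarrow> j < m \<Longrightarrow> A $$ (j, i) = - A $$ (i, j)"
    "\<And>i. i < m \<Longrightarrow> A $$ (i, i) = 0"
  using assms unfolding skew_symmetric_mat_def by blast+

lemma skew_symmetric_matI:
  assumes "A \<in> carrier_mat m m" "\<And>i j. i < m \<Longrightarrow> j < m \<Longrightarrow> A $$ (j, i) = - A $$ (i, j)"
    "\<And>i. i < m \<Longrightarrow> A $$ (i, i) = 0"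
  shows "skew_symmetric_mat m A"
  unfolding skew_symmetric_mat_def using assms by blast

lemma skew_symmetric_J_mat: "skew_symmetric_mat (2 * n) (J_mat n)"
proof (rule skew_symmetric_matI)
  fix i j assume "i < 2 * n" "j < 2 * n"
  then show "J_mat n $$ (j, i) = - J_mat n $$ (i, j)"
    by (cases "even i"; cases "even j") (simp_all add: J_mat_index, presburger+)
qed (simp_all add: J_mat_index)

lemma skew_symmetric_uminus:
  assumes "skew_symmetric_mat m A"
  shows "skew_symmetric_mat m (- A)"
proof (rule skew_symmetric_matI)
  note A = skew_symmetric_matD[OF assms]
  show "- A \<in> carrier_mat m m" using A(1) by simp
  show "(- A) $$ (j, i) = - (- A) $$ (i, j)" if "i < m" "j < m" for i j
    using A(1) A(2)[OF that] that by simp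
  show "(- A) $$ (i, i) = 0" if "i < m" for i
    using A(1) A(3)[OF that] that by simp
qed

lemma skew_symmetric_transpose:
  assumes "skew_symmetric_mat m A"
  shows "transpose_mat A = - A"
proof (rule eq_matI)
  note A = skew_symmetric_matD[OF assms]
  fix i j assume "i < dim_row (- A)" "j < dim_col (- A)"
  then show "transpose_mat A $$ (i, j) = (- A) $$ (i, j)"
    using A(1) A(2)[of i j] by simp
qed (use skew_symmetric_matD(1)[OF assms] in auto)

text \<open>Exchanging the summation variables would only give 2x = 0, which is inconclusive in a
  general commutative ring. The induction instead cancels the last row against the last column and
  uses the zero diagonal.\<close>

lemma skew_form_diag_zero:
  fixes f :: "nat \<Rightarrow> nat \<Rightarrow> 'a :: comm_ring_1"
  assumes "\<And>r s. r < m \<Longrightarrow> s < m \<Longrightarrow> f s r = - f r s" "\<And>r. r < m \<Longrightarrow> f r r = 0"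
  shows "(\<Sum>r<m. \<Sum>s<m. f r s) = 0"
  using assms
proof (induction m)
  case 0
  show ?case by simp
next
  case (Suc m)
  have "(\<Sum>r<m. f r m) = - (\<Sum>s<m. f m s)"
    unfolding sum_negf[symmetric] by (intro sum.cong refl Suc.prems(1)) auto
  moreover have "(\<Sum>r<m. \<Sum>s<m. f r s) = 0"
    by (rule Suc.IH; rule Suc.prems) simp_all
  ultimately show ?case
    using Suc.prems(2)[of m] by (simp add: sum.distrib)
qed

lemma skew_symmetric_congruence:
  assumes X: "skew_symmetric_mat m X" and Q: "Q \<in> carrier_mat m m"
  shows "skew_symmetric_mat m (Q * X * transpose_mat Q)"
proof -
  note X' = skew_symmetric_matD[OF X]
  have idx: "(Q * X * transpose_mat Q) $$ (i, j) =
      (\<Sum>r<m. \<Sum>s<m. Q $$ (i, r) * X $$ (r, s) * Q $$ (j, s))" if "i < m" "j < m" for i j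
  proof -
    have "(Q * X * transpose_mat Q) $$ (i, j) = (\<Sum>s<m. (Q * X) $$ (i, s) * Q $$ (j, s))"
      using Q X'(1) that
      by (subst mult_mat_index_sum[of _ m m _ m]) auto
    also have "\<dots> = (\<Sum>s<m. \<Sum>r<m. Q $$ (i, r) * X $$ (r, s) * Q $$ (j, s))"
      using that
      by (intro sum.cong refl) (simp add: mult_mat_index_sum[OF Q X'(1)] sum_distrib_right del: index_mult_mat)
    finally show ?thesis by (subst sum.swap)
  qed
  have "(Q * X * transpose_mat Q) $$ (j, i) = - (Q * X * transpose_mat Q) $$ (i, j)"
    if ij: "i < m" "j < m" for i j
  proof -
    have "(Q * X * transpose_mat Q) $$ (j, i) =
        (\<Sum>s<m. \<Sum>r<m. Q $$ (j, r) * X $$ (r, s) * Q $$ (i, s))"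
      unfolding idx[OF ij(2,1)] by (rule sum.swap)
    also have "\<dots> = (\<Sum>s<m. \<Sum>r<m. - (Q $$ (i, s) * X $$ (s, r) * Q $$ (j, r)))"
      by (intro sum.cong refl, subst X'(2)) (simp_all add: mult_ac)
    finally show ?thesis unfolding idx[OF ij] by (simp add: sum_negf)
  qed
  moreover have "(Q * X * transpose_mat Q) $$ (i, i) = 0" if i: "i < m" for i
    unfolding idx[OF i i]
    by (rule skew_form_diag_zero) (subst X'(2), auto simp: X'(3) mult_ac)
  moreover have "Q * X * transpose_mat Q \<in> carrier_mat m m" using Q X'(1) by auto
  ultimately show ?thesis by (intro skew_symmetric_matI)
qed

text \<open>With B = A J, the transpose of J A is A J, so \<open>J B^(k+2)\<close> is the congruence
  of \<open>J B^k\<close> by J A. Induction in steps of two starts from J and from J A J, the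
  negative of a congruence of A by J.\<close>

lemma skew_symmetric_J_pow:
  assumes A: "skew_symmetric_mat (2 * n) A"
  shows "skew_symmetric_mat (2 * n) (J_mat n * (A * J_mat n) ^\<^sub>m k)"
proof (induction k rule: induct_nat_012)
  case 0
  show ?case using carrier_matD[OF skew_symmetric_matD(1)[OF A]]
    by (simp add: skew_symmetric_J_mat right_mult_one_mat[OF J_mat_carrier])
next
  let ?J = "J_mat n :: 'a mat"
  note Ac = skew_symmetric_matD(1)[OF A]
  case 1
  have "?J * (A * ?J) = - (?J * A * transpose_mat ?J)"
    using Ac by (simp add: skew_symmetric_transpose[OF skew_symmetric_J_mat]
      assoc_mult_mat[OF J_mat_carrier Ac J_mat_carrier])
  then show ?case
    using Ac by (simp add: skew_symmetric_uminus skew_symmetric_congruence[OF A])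
next
  let ?J = "J_mat n :: 'a mat" and ?B = "A * J_mat n :: 'a mat"
  note Ac = skew_symmetric_matD(1)[OF A]
  have Bc: "?B \<in> carrier_mat (2 * n) (2 * n)" and Pc: "?B ^\<^sub>m k \<in> carrier_mat (2 * n) (2 * n)" for k
    using Ac by auto
  case (ge2 k)
  have "transpose_mat (?J * A) = ?B"
    using Ac by (simp add: transpose_mult[OF J_mat_carrier Ac] skew_symmetric_transpose[OF A]
      skew_symmetric_transpose[OF skew_symmetric_J_mat])
  moreover have "?J * ?B ^\<^sub>m Suc (Suc k) = (?J * A) * (?J * ?B ^\<^sub>m k) * ?B"
  proof -
    have "?J * ?B ^\<^sub>m Suc (Suc k) = ?J * ((?B * ?B ^\<^sub>m k) * ?B)"
      using pow_mat_Suc_left[OF Bc, of k] by simp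
    also have "\<dots> = (?J * (?B * ?B ^\<^sub>m k)) * ?B"
      by (rule assoc_mult_mat[symmetric, OF J_mat_carrier mult_carrier_mat[OF Bc Pc] Bc])
    also have "?B * ?B ^\<^sub>m k = A * (?J * ?B ^\<^sub>m k)"
      by (rule assoc_mult_mat[OF Ac J_mat_carrier Pc])
    also have "?J * (A * (?J * ?B ^\<^sub>m k)) = (?J * A) * (?J * ?B ^\<^sub>m k)"
      by (rule assoc_mult_mat[symmetric, OF J_mat_carrier Ac mult_carrier_mat[OF J_mat_carrier Pc]])
    finally show ?thesis .
  qed
  ultimately show ?case
    using skew_symmetric_congruence[OF ge2(1) mult_carrier_mat[OF J_mat_carrier Ac]] by simp
qed

text \<open>Left multiplication by J exchanges the two rows of each pair up to sign, so
  skew-symmetry of \<open>J B^k\<close> translates into relations between entries of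
  \<open>B^k\<close>. The first three concern one pair; the last two link two pairs and serve the
  exchange of deletions.\<close>

lemma resolvent_pair_relations:
  fixes A :: "'a :: comm_ring_1 mat"
  assumes A: "skew_symmetric_mat (2 * n) A" and p: "p < n" and q: "q < n"
  defines "g \<equiv> resolvent (A * J_mat n)"
  shows "g (2 * p) (2 * p + 1) = 0" "g (2 * p + 1) (2 * p) = 0"
    "g (2 * p + 1) (2 * p + 1) = g (2 * p) (2 * p)"
    "g (2 * q) (2 * p + 1) = - g (2 * p) (2 * q + 1)"
    "g (2 * q + 1) (2 * p) = - g (2 * p + 1) (2 * q)"
proof -
  have Bc: "(A * J_mat n) ^\<^sub>m k \<in> carrier_mat (2 * n) (2 * n)" for k
    using skew_symmetric_matD(1)[OF A] by simp
  have even: "(J_mat n * (A * J_mat n) ^\<^sub>m k) $$ (2 * r, j) = ((A * J_mat n) ^\<^sub>m k) $$ (2 * r + 1, j)"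
    and odd: "(J_mat n * (A * J_mat n) ^\<^sub>m k) $$ (2 * r + 1, j) = - ((A * J_mat n) ^\<^sub>m k) $$ (2 * r, j)"
    if "r < n" "j < 2 * n" for r j k
    using that by (simp_all add: J_mat_mult_index[OF Bc])
  have sk: "(J_mat n * (A * J_mat n) ^\<^sub>m k) $$ (j, i) = - (J_mat n * (A * J_mat n) ^\<^sub>m k) $$ (i, j)"
    "(J_mat n * (A * J_mat n) ^\<^sub>m k) $$ (i, i) = 0" if "i < 2 * n" "j < 2 * n" for i j k
    using skew_symmetric_matD(2,3)[OF skew_symmetric_J_pow[OF A]] that by blast+
  have "((A * J_mat n) ^\<^sub>m k) $$ (2 * p, 2 * p + 1) = 0" for k
    using sk(2)[of "2 * p + 1" "2 * p + 1" k] odd[of p "2 * p + 1" k] p by simp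
  then show "g (2 * p) (2 * p + 1) = 0" by (simp add: g_def resolvent_def fps_eq_iff)
  have "((A * J_mat n) ^\<^sub>m k) $$ (2 * p + 1, 2 * p) = 0" for k
    using sk(2)[of "2 * p" "2 * p" k] even[of p "2 * p" k] p by simp
  then show "g (2 * p + 1) (2 * p) = 0" by (simp add: g_def resolvent_def fps_eq_iff)
  have "((A * J_mat n) ^\<^sub>m k) $$ (2 * p + 1, 2 * p + 1) = ((A * J_mat n) ^\<^sub>m k) $$ (2 * p, 2 * p)" for k
    using sk(1)[of "2 * p" "2 * p + 1" k] even[of p "2 * p + 1" k] odd[of p "2 * p" k] p by simp
  then show "g (2 * p + 1) (2 * p + 1) = g (2 * p) (2 * p)"
    by (simp add: g_def resolvent_def fps_eq_iff)
  have "((A * J_mat n) ^\<^sub>m k) $$ (2 * q, 2 * p + 1) = - ((A * J_mat n) ^\<^sub>m k) $$ (2 * p, 2 * q + 1)" for k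
    using sk(1)[of "2 * p + 1" "2 * q + 1" k] odd[of q "2 * p + 1" k] odd[of p "2 * q + 1" k] p q
    by simp
  then show "g (2 * q) (2 * p + 1) = - g (2 * p) (2 * q + 1)"
    by (simp add: g_def resolvent_def fps_eq_iff)
  have "((A * J_mat n) ^\<^sub>m k) $$ (2 * q + 1, 2 * p) = - ((A * J_mat n) ^\<^sub>m k) $$ (2 * p + 1, 2 * q)" for k
    using sk(1)[of "2 * p" "2 * q" k] even[of q "2 * p" k] even[of p "2 * q" k] p q by simp
  then show "g (2 * q + 1) (2 * p) = - g (2 * p + 1) (2 * q)"
    by (simp add: g_def resolvent_def fps_eq_iff)
qed

section \<open>Pair deletion for skew-symmetric matrices\<close>

lemma skew_symmetric_del_pair:
  assumes "skew_symmetric_mat (2 * Suc n) A"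
  shows "skew_symmetric_mat (2 * n) (del_pair p A)"
proof -
  have Ac: "A \<in> carrier_mat (2 * n + 2) (2 * n + 2)"
    using skew_symmetric_matD(1)[OF assms] by simp
  have lt: "del_index p i < 2 * Suc n" if "i < 2 * n" for i
    using del_index_less[OF that, of p] by simp
  note A = skew_symmetric_matD(2,3)[OF assms]
  show ?thesis
  proof (rule skew_symmetric_matI)
    show "del_pair p A $$ (j, i) = - del_pair p A $$ (i, j)" if "i < 2 * n" "j < 2 * n" for i j
      unfolding del_pair_index[OF Ac that] del_pair_index[OF Ac that(2,1)]
      by (intro A lt that)
    show "del_pair p A $$ (i, i) = 0" if "i < 2 * n" for i
      unfolding del_pair_index[OF Ac that that] by (intro A lt that)
  qed (use Ac in simp)
qed

text \<open>J mixes columns only within a pair, so deleting a whole pair leaves a product of the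
  same shape.\<close>

lemma del_pair_mult_J:
  fixes A :: "'a :: comm_ring_1 mat"
  assumes "A \<in> carrier_mat (2 * n + 2) (2 * n + 2)"
  shows "del_pair p (A * J_mat (Suc n)) = del_pair p A * J_mat n"
proof (rule eq_matI)
  have Ac: "A \<in> carrier_mat (2 * n + 2) (2 * Suc n)" using assms by simp
  have Bc: "A * J_mat (Suc n) \<in> carrier_mat (2 * n + 2) (2 * n + 2)" using assms by auto
  fix i j
  assume "i < dim_row (del_pair p A * J_mat n)" "j < dim_col (del_pair p A * J_mat n)"
  then have i: "i < 2 * n" and j: "j < 2 * n" using del_pair_carrier[OF assms, of p] by auto
  have par: "even (del_index p j) \<longleftrightarrow> even j" by (simp add: del_index_def)
  have lt: "del_index p j < 2 * Suc n" using del_index_less[OF j, of p] by simp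
  have "del_pair p (A * J_mat (Suc n)) $$ (i, j) = (if even j then - A $$ (del_index p i, Suc (del_index p j))
      else A $$ (del_index p i, del_index p j - 1))"
    by (simp only: del_pair_index[OF Bc i j] mult_J_mat_index[OF Ac del_index_less[OF i] lt] par)
  also have "\<dots> = (del_pair p A * J_mat n) $$ (i, j)"
  proof (cases "even j")
    case True
    then have "Suc j < 2 * n" using j by presburger
    moreover have "del_index p (Suc j) = Suc (del_index p j)"
      using True by (auto simp: del_index_def; presburger)
    ultimately show ?thesis
      using True by (simp add: mult_J_mat_index[OF del_pair_carrier[OF assms] i j] del_pair_index[OF assms i])
  next
    case False
    then have "j - 1 < 2 * n" using j by presburger
    moreover have "del_index p (j - 1) = del_index p j - 1"
      using False by (auto simp: del_index_def; presburger)
    ultimately show ?thesis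
      using False by (simp add: mult_J_mat_index[OF del_pair_carrier[OF assms] i j] del_pair_index[OF assms i])
  qed
  finally show "del_pair p (A * J_mat (Suc n)) $$ (i, j) = (del_pair p A * J_mat n) $$ (i, j)" .
qed (use assms in \<open>auto simp: del_pair_def\<close>)

lemma resolvent_pair_skew:
  assumes A: "skew_symmetric_mat (2 * Suc n) A" and p: "p < Suc n"
  shows "resolvent_pair (2 * n) p (A * J_mat (Suc n))"
proof
  show "A * J_mat (Suc n) \<in> carrier_mat (2 * n + 2) (2 * n + 2)"
    using skew_symmetric_matD(1)[OF A] by auto
qed (use p resolvent_pair_relations(1-3)[OF A p p] in auto)

text \<open>Once pair 0 is gone, the original pair \<open>Suc p\<close> is renumbered p, whereas
  deleting \<open>Suc p\<close> leaves pair 0 in place.\<close>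

lemma del_pair_comm:
  assumes "A \<in> carrier_mat ((m + 2) + 2) ((m + 2) + 2)"
  shows "del_pair p (del_pair 0 A) = del_pair 0 (del_pair (Suc p) A)"
proof (rule eq_matI)
  have Ac: "A \<in> carrier_mat ((m + 2) + 2) ((m + 2) + 2)" using assms by simp
  fix i j
  assume "i < dim_row (del_pair 0 (del_pair (Suc p) A))" "j < dim_col (del_pair 0 (del_pair (Suc p) A))"
  then have "i < m" "j < m" using assms by (auto simp: del_pair_def)
  moreover have "del_index 0 (del_index p i) = del_index (Suc p) (del_index 0 i)" for i
    by (auto simp: del_index_def)
  ultimately show "del_pair p (del_pair 0 A) $$ (i, j) = del_pair 0 (del_pair (Suc p) A) $$ (i, j)"
    using del_index_less
    by (simp add: del_pair_index[OF del_pair_carrier[OF Ac]] del_pair_index[OF Ac])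
qed (auto simp: del_pair_def)

text \<open>Both sides are the Pfaffian minor of the resolvent on the pairs \<open>0\<close> and \<open>Suc p\<close>,
  which does not depend on the order in which the two pairs are deleted.\<close>

lemma resolvent_del_pair_swap:
  fixes A :: "'a :: comm_ring_1 mat"
  assumes A: "skew_symmetric_mat (2 * Suc (Suc n)) A" and p: "p < Suc n"
  defines "B \<equiv> A * J_mat (Suc (Suc n))"
  shows "resolvent B 0 0 * resolvent (del_pair 0 A * J_mat (Suc n)) (2 * p) (2 * p) =
    resolvent B (2 * Suc p) (2 * Suc p) * resolvent (del_pair (Suc p) A * J_mat (Suc n)) 0 0"
proof -
  have Ac: "A \<in> carrier_mat (2 * Suc n + 2) (2 * Suc n + 2)"
    using skew_symmetric_matD(1)[OF A] by simp
  interpret P: resolvent_pair "2 * Suc n" 0 B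
    unfolding B_def by (rule resolvent_pair_skew[OF A]) simp
  interpret Q: resolvent_pair "2 * Suc n" "Suc p" B
    unfolding B_def by (rule resolvent_pair_skew[OF A]) (use p in simp)
  \<comment> \<open>The last products in the two Schur expansions involve different entries; by
    these relations they agree, since the two signs cancel.\<close>
  have rel: "resolvent B 0 (Suc (2 * Suc p)) = - resolvent B (2 * Suc p) 1"
    "resolvent B (2 * Suc p + 1) 0 = - resolvent B 1 (2 * Suc p)"
    using resolvent_pair_relations(4)[OF A, of "Suc p" 0] resolvent_pair_relations(5)[OF A, of 0 "Suc p"] p
    unfolding B_def by simp_all
  have "resolvent B 0 0 * resolvent (del_pair 0 B) (2 * p) (2 * p) =
      resolvent B 0 0 * resolvent B (2 * Suc p) (2 * Suc p)
      - resolvent B (2 * Suc p) 0 * resolvent B 0 (2 * Suc p)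
      - resolvent B (2 * Suc p) 1 * resolvent B 1 (2 * Suc p)"
    using P.resolvent_del_pair[of "2 * p" "2 * p"] p by (simp add: del_index_def)
  also have "\<dots> = resolvent B (2 * Suc p) (2 * Suc p) * resolvent B 0 0
      - resolvent B 0 (2 * Suc p) * resolvent B (2 * Suc p) 0
      - resolvent B 0 (Suc (2 * Suc p)) * resolvent B (2 * Suc p + 1) 0"
    unfolding rel by (simp add: algebra_simps)
  also have "\<dots> = resolvent B (2 * Suc p) (2 * Suc p) * resolvent (del_pair (Suc p) B) 0 0"
    using Q.resolvent_del_pair[of 0 0] by (simp add: del_index_def)
  finally have "resolvent B 0 0 * resolvent (del_pair 0 B) (2 * p) (2 * p) =
      resolvent B (2 * Suc p) (2 * Suc p) * resolvent (del_pair (Suc p) B) 0 0" .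
  then show ?thesis unfolding B_def del_pair_mult_J[OF Ac] .
qed

section \<open>Pfaffian coefficients as power series\<close>

text \<open>The reversed Pfaffian polynomial: \<open>pf_coeffs\<close> lists q_n first, so the
  coefficient of \<open>X^r\<close> is q_(n-r).\<close>

definition pf_series :: "nat \<Rightarrow> 'a :: comm_ring_1 mat \<Rightarrow> 'a fps" where
  "pf_series n A = Abs_fps (\<lambda>r. if r \<le> n then pf_coeffs n A $ r else 0)"

text \<open>Symbol of the Toeplitz matrix \<open>pf_P\<close>, whose action on a vector is a
  truncated product of power series.\<close>

definition pf_t_series :: "nat \<Rightarrow> 'a :: comm_ring_1 mat \<Rightarrow> 'a fps" where
  "pf_t_series n A = Abs_fps (\<lambda>i. pf_t n A (int i))"

lemma pf_M_eq_del_pair: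
  assumes "A \<in> carrier_mat (2 * Suc n) (2 * Suc n)"
  shows "pf_M (Suc n) A = del_pair 0 A"
  using assms by (auto simp: pf_M_def del_pair_def del_index_def intro!: eq_matI)

lemma dim_pf_coeffs [simp]: "dim_vec (pf_coeffs n A) = Suc n"
  by (induction n A rule: pf_coeffs.induct) (simp_all add: pf_P_def)

text \<open>The conventional value at \<open>n = 0\<close> makes the base case \<open>n = 1\<close>
  an instance of the general recursion.\<close>

lemma pf_coeffs_Suc:
  assumes "r \<le> Suc n"
  shows "pf_coeffs (Suc n) A $ r =
    (\<Sum>c<Suc n. pf_t (Suc n) A (int r - int c) * pf_coeffs n (pf_M (Suc n) A) $ c)"
proof (cases n)
  case 0
  then have "r = 0 \<or> r = 1" using assms by auto
  then show ?thesis using 0 by (auto simp: pf_t_def)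
next
  case (Suc k)
  then show ?thesis using assms
    by (simp add: pf_P_def scalar_prod_def lessThan_atLeast0)
qed

text \<open>Summing over i >= 2 turns the powers of M J into its resolvent, and the row R J is row 0
  of A J without its first two entries.\<close>

lemma pf_t_series_eq:
  fixes A :: "'a :: comm_ring_1 mat"
  assumes A: "skew_symmetric_mat (2 * Suc n) A"
  defines "B \<equiv> A * J_mat (Suc n)"
  shows "pf_t_series (Suc n) A = 1 + fps_X * (fps_const (A $$ (0, 1)) +
    fps_X * (\<Sum>r<2 * n. \<Sum>l<2 * n. fps_const (B $$ (0, r + 2)) *
      resolvent (del_pair 0 A * J_mat n) r l * fps_const (A $$ (l + 2, 1))))"
proof (rule fps_ext)
  have Ac: "A \<in> carrier_mat (2 * Suc n) (2 * Suc n)" using skew_symmetric_matD(1)[OF A] .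
  define N where "N = del_pair 0 A * J_mat n"
  have Mc: "del_pair 0 A \<in> carrier_mat (2 * n) (2 * n)"
    using Ac by (intro del_pair_carrier) simp
  then have Nc: "N ^\<^sub>m k \<in> carrier_mat (2 * n) (2 * n)" for k by (simp add: N_def)
  \<comment> \<open>A matrix with one row, so that associativity of matrix products can move J from
    the power onto R.\<close>
  define R where "R = mat 1 (2 * n) (\<lambda>(i, j). A $$ (0, j + 2))"
  have Rc: "R \<in> carrier_mat 1 (2 * n)" by (simp add: R_def)
  have RJ: "(R * J_mat n) $$ (0, r) = B $$ (0, r + 2)" if r: "r < 2 * n" for r
  proof -
    have "even r \<Longrightarrow> Suc r < 2 * n" using r by presburger
    then have "(R * J_mat n) $$ (0, r) = (if even r then - A $$ (0, r + 3) else A $$ (0, r + 1))"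
      using r mult_J_mat_index[OF Rc _ r] by (simp add: R_def numeral_3_eq_3 del: index_mult_mat(1))
    also have "\<dots> = B $$ (0, r + 2)"
      using r by (simp add: B_def mult_J_mat_index[OF Ac] numeral_3_eq_3 del: index_mult_mat)
    finally show ?thesis .
  qed
  fix i
  show "fps_nth (pf_t_series (Suc n) A) i = fps_nth (1 + fps_X * (fps_const (A $$ (0, 1)) +
    fps_X * (\<Sum>r<2 * n. \<Sum>l<2 * n. fps_const (B $$ (0, r + 2)) *
      resolvent (del_pair 0 A * J_mat n) r l * fps_const (A $$ (l + 2, 1))))) i"
  proof -
    consider "i = 0" | "i = 1" | k where "i = k + 2"
      by (metis One_nat_def Suc_eq_plus1 add_2_eq_Suc' not0_implies_Suc)
    then show ?thesis
    proof cases
      case 3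
      have "pf_t (Suc n) A (int i) = pf_R (Suc n) A \<bullet> ((J_mat n * N ^\<^sub>m k) *\<^sub>v pf_S (Suc n) A)"
        using 3 by (simp add: pf_t_def N_def pf_M_eq_del_pair[OF Ac])
      also have "\<dots> = (\<Sum>j<2 * n. A $$ (0, j + 2) *
          (\<Sum>l<2 * n. (J_mat n * N ^\<^sub>m k) $$ (j, l) * A $$ (l + 2, 1)))"
        using carrier_matD[OF Nc[of k]] by (simp add: scalar_prod_def pf_R_def pf_S_def lessThan_atLeast0 del: index_mult_mat(1))
      also have "\<dots> = (\<Sum>l<2 * n. (\<Sum>j<2 * n. R $$ (0, j) * (J_mat n * N ^\<^sub>m k) $$ (j, l)) * A $$ (l + 2, 1))"
        unfolding sum_distrib_left sum_distrib_right
        by (subst sum.swap) (simp add: R_def mult.assoc del: index_mult_mat(1))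
      also have "\<dots> = (\<Sum>l<2 * n. (R * (J_mat n * N ^\<^sub>m k)) $$ (0, l) * A $$ (l + 2, 1))"
        by (intro sum.cong refl)
           (simp add: mult_mat_index_sum[OF Rc mult_carrier_mat[OF J_mat_carrier Nc]] del: index_mult_mat(1))
      also have "\<dots> = (\<Sum>l<2 * n. (\<Sum>r<2 * n. B $$ (0, r + 2) * (N ^\<^sub>m k) $$ (r, l)) * A $$ (l + 2, 1))"
        unfolding assoc_mult_mat[OF Rc J_mat_carrier Nc, symmetric]
        by (intro sum.cong refl)
           (simp add: mult_mat_index_sum[OF mult_carrier_mat[OF Rc J_mat_carrier] Nc] RJ del: index_mult_mat(1))
      also have "\<dots> = (\<Sum>r<2 * n. \<Sum>l<2 * n. B $$ (0, r + 2) * (N ^\<^sub>m k) $$ (r, l) * A $$ (l + 2, 1))"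
        unfolding sum_distrib_right by (rule sum.swap)
      finally show ?thesis
        using 3 by (simp add: pf_t_series_def resolvent_def fps_sum_nth N_def del: index_mult_mat(1))
    qed (simp_all add: pf_t_series_def pf_t_def)
  qed
qed

text \<open>Row 0 of G = 1 + X B G, with the column below the pair eliminated by
  \<open>column_even\<close>, becomes g = 1 - (T - 1) g, where g is the corner entry and T the
  series of the t_i.\<close>

lemma pf_t_series_mult_resolvent:
  fixes A :: "'a :: comm_ring_1 mat"
  assumes A: "skew_symmetric_mat (2 * Suc n) A"
  shows "pf_t_series (Suc n) A * resolvent (A * J_mat (Suc n)) 0 0 = 1"
proof -
  let ?B = "A * J_mat (Suc n)"
  let ?h = "resolvent (del_pair 0 A * J_mat n)" and ?g = "resolvent ?B"
  let ?R = "\<lambda>r. fps_const (?B $$ (0, r + 2))" and ?S = "\<lambda>l. fps_const (A $$ (l + 2, 1))"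
  have Ac: "A \<in> carrier_mat (2 * Suc n) (2 * Suc n)" using skew_symmetric_matD(1)[OF A] .
  then have Ac': "A \<in> carrier_mat (2 * n + 2) (2 * n + 2)" by simp
  interpret P: resolvent_pair "2 * n" 0 ?B
    by (rule resolvent_pair_skew[OF A]) simp
  \<comment> \<open>Column 0 of A J is minus column 1 of A; this is how the second column S
    enters.\<close>
  have B00: "?B $$ (0, 0) = - A $$ (0, 1)"
    by (simp add: mult_J_mat_index[OF Ac] del: index_mult_mat(1))
  have Bl0: "?B $$ (l + 2, 0) = - A $$ (l + 2, 1)" if "l < 2 * n" for l
    using that by (simp add: mult_J_mat_index[OF Ac] del: index_mult_mat(1))
  have col: "?g (l + 2) 0 = - fps_X * (\<Sum>r<2 * n. ?h l r * ?S r) * ?g 0 0" if "l < 2 * n" for l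
  proof -
    have "?g (l + 2) 0 = fps_X * (\<Sum>r<2 * n. ?h l r * (fps_const (?B $$ (r + 2, 0)) * ?g 0 0))"
      using P.column_even[OF that] by (simp add: del_index_def del_pair_mult_J[OF Ac'] del: index_mult_mat(1))
    also have "(\<Sum>r<2 * n. ?h l r * (fps_const (?B $$ (r + 2, 0)) * ?g 0 0)) =
        - (\<Sum>r<2 * n. ?h l r * ?S r) * ?g 0 0"
      unfolding sum_distrib_right sum_negf[symmetric]
      by (intro sum.cong refl, simp only: lessThan_iff Bl0)
         (simp add: fps_const_neg[symmetric] mult_ac del: fps_const_neg)
    finally show ?thesis by simp
  qed
  have "?g 0 0 = 1 + fps_X * (\<Sum>l<2 * n + 2. fps_const (?B $$ (0, l)) * ?g l 0)"
    using resolvent_left[OF P.carrier, of 0 0] by simp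
  also have "(\<Sum>l<2 * n + 2. fps_const (?B $$ (0, l)) * ?g l 0) =
      - fps_const (A $$ (0, 1)) * ?g 0 0 + (\<Sum>l<2 * n. ?R l * ?g (l + 2) 0)"
    using P.lower_zero B00 sum_del_index[of 0 "2 * n" "\<lambda>l. fps_const (?B $$ (0, l)) * ?g l 0"]
    by (simp add: del_index_def del: index_mult_mat(1))
  also have "(\<Sum>l<2 * n. ?R l * ?g (l + 2) 0) =
      (\<Sum>l<2 * n. ?R l * (- fps_X * (\<Sum>r<2 * n. ?h l r * ?S r) * ?g 0 0))"
    by (intro sum.cong refl, simp only: lessThan_iff col)
  also have "\<dots> = - fps_X * (\<Sum>r<2 * n. \<Sum>l<2 * n. ?R r * ?h r l * ?S l) * ?g 0 0"
    by (simp add: sum_distrib_left sum_distrib_right sum_negf mult_ac del: index_mult_mat(1))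
  finally have g: "?g 0 0 = 1 + fps_X * (- fps_const (A $$ (0, 1)) * ?g 0 0 +
      - fps_X * (\<Sum>r<2 * n. \<Sum>l<2 * n. ?R r * ?h r l * ?S l) * ?g 0 0)" .
  have "pf_t_series (Suc n) A * ?g 0 0 = ?g 0 0 + fps_X * (fps_const (A $$ (0, 1)) * ?g 0 0 +
      fps_X * (\<Sum>r<2 * n. \<Sum>l<2 * n. ?R r * ?h r l * ?S l) * ?g 0 0)"
    unfolding pf_t_series_eq[OF A] by (simp add: algebra_simps)
  also have "\<dots> = 1"
    by (subst (1) g) (simp add: algebra_simps del: fps_const_neg)
  finally show ?thesis .
qed

text \<open>The matrix recursion computes the product only up to degree \<open>Suc n\<close>. The
  assumption \<open>vanish\<close> ensures that the product has no terms beyond that degree.\<close>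

lemma pf_series_Suc:
  fixes A :: "'a :: comm_ring_1 mat"
  assumes A: "skew_symmetric_mat (2 * Suc n) A"
    and vanish: "\<And>i j k. i < 2 * n \<Longrightarrow> j < 2 * n \<Longrightarrow> n \<le> k \<Longrightarrow>
      fps_nth (pf_series n (del_pair 0 A) * resolvent (del_pair 0 A * J_mat n) i j) k = 0"
  shows "pf_series (Suc n) A = pf_t_series (Suc n) A * pf_series n (del_pair 0 A)"
proof (rule fps_ext)
  let ?B = "A * J_mat (Suc n)" and ?M = "del_pair 0 A"
  have M: "pf_M (Suc n) A = ?M"
    by (rule pf_M_eq_del_pair[OF skew_symmetric_matD(1)[OF A]])
  fix r
  show "fps_nth (pf_series (Suc n) A) r = fps_nth (pf_t_series (Suc n) A * pf_series n ?M) r"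
  proof (cases "r \<le> Suc n")
    case True
    have "fps_nth (pf_series (Suc n) A) r =
        (\<Sum>c<Suc n. pf_t (Suc n) A (int r - int c) * pf_coeffs n ?M $ c)"
      using True by (simp add: pf_series_def pf_coeffs_Suc M del: sum.lessThan_Suc)
    \<comment> \<open>The terms with c > r drop out because \<open>pf_t\<close> is zero at negative
      arguments.\<close>
    also have "\<dots> = (\<Sum>c\<in>{..n} \<inter> {..r}. pf_t (Suc n) A (int r - int c) * pf_coeffs n ?M $ c)"
      by (rule sum.mono_neutral_right) (auto simp: pf_t_def)
    also have "\<dots> = (\<Sum>c\<in>{..n} \<inter> {..r}. fps_nth (pf_series n ?M) c * fps_nth (pf_t_series (Suc n) A) (r - c))"
      by (intro sum.cong refl) (auto simp: pf_series_def pf_t_series_def of_nat_diff)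
    also have "\<dots> = (\<Sum>c = 0..r. fps_nth (pf_series n ?M) c * fps_nth (pf_t_series (Suc n) A) (r - c))"
      by (rule sum.mono_neutral_left) (auto simp: pf_series_def)
    finally show ?thesis
      by (simp add: fps_mult_nth mult.commute[of "pf_t_series (Suc n) A"])
  next
    case False
    \<comment> \<open>The closed form carries two factors X in front of the resolvent of M J, so
      degree r is governed by degree \<open>r - 2\<close>, where \<open>vanish\<close>
      applies.\<close>
    then obtain k where k: "r = Suc (Suc k)" "n \<le> k"
      by (metis Suc_le_D Suc_le_mono not_less_eq_eq)
    let ?F = "pf_series n ?M"
    have "pf_t_series (Suc n) A * ?F = ?F + fps_X * (fps_const (A $$ (0, 1)) * ?F +
      fps_X * (\<Sum>i<2 * n. \<Sum>l<2 * n. fps_const (?B $$ (0, i + 2)) *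
        (fps_const (A $$ (l + 2, 1)) * (?F * resolvent (?M * J_mat n) i l))))"
      unfolding pf_t_series_eq[OF A]
      by (simp add: algebra_simps sum_distrib_left sum_distrib_right del: index_mult_mat(1))
    then have "fps_nth (pf_t_series (Suc n) A * ?F) r = fps_nth ?F r + A $$ (0, 1) * fps_nth ?F (Suc k) +
        (\<Sum>i<2 * n. \<Sum>l<2 * n. ?B $$ (0, i + 2) *
          (A $$ (l + 2, 1) * fps_nth (?F * resolvent (?M * J_mat n) i l) k))"
      by (simp add: k fps_sum_nth del: index_mult_mat(1))
    also have "\<dots> = 0"
    proof -
      have "fps_nth ?F r = 0" "fps_nth ?F (Suc k) = 0" using k by (simp_all add: pf_series_def)
      then show ?thesis using k by (simp add: vanish del: index_mult_mat(1))
    qed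
    finally show ?thesis using False by (simp add: pf_series_def)
  qed
qed

section \<open>Deleting an arbitrary pair\<close>

text \<open>The two claims are proved together. The degree bound one size down validates
  \<open>pf_series_Suc\<close>, hence the first claim for pair 0; exchanging deletions extends it to
  every pair; and the first claim with the smaller degree bound controls whole columns of the
  resolvent.\<close>

lemma pf_series_resolvent:
  fixes A :: "'a :: comm_ring_1 mat"
  assumes "skew_symmetric_mat (2 * n) A"
  shows "(\<forall>p<n. pf_series n A * resolvent (A * J_mat n) (2 * p) (2 * p) = pf_series (n - 1) (del_pair p A))
    \<and> (\<forall>i<2 * n. \<forall>j<2 * n. \<forall>k\<ge>n. fps_nth (pf_series n A * resolvent (A * J_mat n) i j) k = 0)"
  using assms
proof (induction n arbitrary: A)
  case 0
  then show ?case by simp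
next
  case (Suc n)
  note A = Suc.prems
  have Ac: "A \<in> carrier_mat (2 * n + 2) (2 * n + 2)" using skew_symmetric_matD(1)[OF A] by simp
  have IH1: "pf_series n A' * resolvent (A' * J_mat n) (2 * p) (2 * p) = pf_series (n - 1) (del_pair p A')"
    if "skew_symmetric_mat (2 * n) A'" "p < n" for A' :: "'a mat" and p
    using Suc.IH[OF that(1)] that(2) by blast
  have IH2: "fps_nth (pf_series n A' * resolvent (A' * J_mat n) i j) k = 0"
    if "skew_symmetric_mat (2 * n) A'" "i < 2 * n" "j < 2 * n" "n \<le> k" for A' :: "'a mat" and i j k
    using Suc.IH[OF that(1)] that(2-) by blast
  let ?g = "resolvent (A * J_mat (Suc n))"
  note skew_del = skew_symmetric_del_pair[OF A]
  have del0: "pf_series (Suc n) A * ?g 0 0 = pf_series n (del_pair 0 A)"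
  proof -
    have "pf_series (Suc n) A * ?g 0 0 =
        (pf_t_series (Suc n) A * ?g 0 0) * pf_series n (del_pair 0 A)"
      by (simp add: pf_series_Suc[OF A IH2[OF skew_del]] mult_ac)
    then show ?thesis by (simp add: pf_t_series_mult_resolvent[OF A])
  qed
  have del: "pf_series (Suc n) A * ?g (2 * p) (2 * p) = pf_series n (del_pair p A)" if p: "p < Suc n" for p
  proof (cases p)
    case 0
    then show ?thesis using del0 by simp
  next
    case (Suc p')
    then obtain m where n: "n = Suc m" and p': "p' < n" using p by (cases n) auto
    let ?h = "resolvent (del_pair 0 A * J_mat n) (2 * p') (2 * p')"
    let ?d = "resolvent (del_pair p A * J_mat n) 0 0"
    \<comment> \<open>\<open>?T\<close> is the inverse of \<open>?d\<close>; inserting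
      \<open>?d * ?T\<close> makes the exchange identity applicable without division.\<close>
    let ?T = "pf_t_series n (del_pair p A)"
    have Ac2: "A \<in> carrier_mat ((2 * m + 2) + 2) ((2 * m + 2) + 2)" using Ac n by simp
    have T: "?d * ?T = 1"
      using pf_t_series_mult_resolvent[of m "del_pair p A"] skew_del n by (simp add: mult.commute)
    have swap: "?g 0 0 * ?h = ?g (2 * p) (2 * p) * ?d"
      using resolvent_del_pair_swap[of m A p'] A p' unfolding n Suc by blast
    have "pf_series (Suc n) A * ?g (2 * p) (2 * p) = pf_series (Suc n) A * (?g (2 * p) (2 * p) * ?d) * ?T"
      using T by (simp add: mult.assoc)
    also have "\<dots> = (pf_series (Suc n) A * ?g 0 0) * ?h * ?T"
      unfolding swap[symmetric] by (simp add: mult.assoc)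
    also have "\<dots> = pf_series m (del_pair p' (del_pair 0 A)) * ?T"
      unfolding del0 IH1[OF skew_del p'] using n by simp
    \<comment> \<open>The matrix with both pairs removed is now read as \<open>del_pair p A\<close>
      with its pair 0 removed, so the induction hypothesis is used in reverse.\<close>
    also have "\<dots> = (pf_series n (del_pair p A) * ?d) * ?T"
      using IH1[OF skew_del, of 0 p] n by (simp add: Suc del_pair_comm[OF Ac2])
    also have "\<dots> = pf_series n (del_pair p A)"
      using T by (simp add: mult.assoc)
    finally show ?thesis .
  qed
  have "fps_nth (pf_series (Suc n) A * ?g i j) k = 0"
    if i: "i < 2 * Suc n" and j: "j < 2 * Suc n" and k: "Suc n \<le> k" for i j k
  proof -
    \<comment> \<open>The pair to eliminate is the one containing column j. Rows inside it give zero
      or the diagonal entry; the others are covered by \<open>column\<close>.\<close>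
    define p where "p = j div 2"
    have p: "p < Suc n" and jp: "j = 2 * p \<or> j = 2 * p + 1" using j by (auto simp: p_def)
    interpret P: resolvent_pair "2 * n" p "A * J_mat (Suc n)"
      by (rule resolvent_pair_skew[OF A p])
    have diag: "fps_nth (pf_series (Suc n) A * ?g (2 * p) (2 * p)) k = 0"
      unfolding del[OF p] using k by (simp add: pf_series_def)
    \<comment> \<open>The free coefficients c serve even and odd columns alike. The factor X lowers
      the degree to \<open>k - 1\<close>, which is still at least n, as the induction hypothesis
      demands.\<close>
    have column: "fps_nth (pf_series (Suc n) A * (fps_X * (\<Sum>l<2 * n.
        resolvent (del_pair p (A * J_mat (Suc n))) i' l * (fps_const (c l) * ?g (2 * p) (2 * p))))) k = 0"
      if i': "i' < 2 * n" for i' and c :: "nat \<Rightarrow> 'a"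
    proof -
      have "pf_series (Suc n) A * (fps_X * (\<Sum>l<2 * n.
          resolvent (del_pair p (A * J_mat (Suc n))) i' l * (fps_const (c l) * ?g (2 * p) (2 * p)))) =
        fps_X * (\<Sum>l<2 * n. fps_const (c l) * ((pf_series (Suc n) A * ?g (2 * p) (2 * p)) *
          resolvent (del_pair p A * J_mat n) i' l))"
        by (simp add: del_pair_mult_J[OF Ac] sum_distrib_left mult_ac)
      then show ?thesis
        using k i' by (simp add: del[OF p] fps_sum_nth IH2[OF skew_del])
    qed
    consider "i = 2 * p" | "i = 2 * p + 1" | i' where "i' < 2 * n" "i = del_index p i'"
      using lessThan_del_index[of p "2 * n"] p i by (auto simp: set_eq_iff)
    then show ?thesis
    proof cases
      case 1
      then show ?thesis using jp diag P.upper_zero by auto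
    next
      case 2
      then show ?thesis using jp diag P.lower_zero P.diag_eq by auto
    next
      case 3
      then show ?thesis
        using jp P.column_even[OF 3(1)] P.column_odd[OF 3(1)] column[OF 3(1)] by auto
    qed
  qed
  then show ?case using del by simp
qed

section \<open>The Cayley-Hamilton identity\<close>

lemma finsum_module_mat:
  fixes f :: "'b \<Rightarrow> 'a :: comm_ring_1 mat"
  assumes "finite F" "\<And>x. x \<in> F \<Longrightarrow> f x \<in> carrier_mat nr nc"
  shows "finsum (module_mat TYPE('a) nr nc) f F = mat nr nc (\<lambda>(i, j). \<Sum>x\<in>F. f x $$ (i, j))"
proof -
  interpret abelian_group "module_mat TYPE('a) nr nc" by (rule abelian_group_mat)
  show ?thesis
    using assms
  proof (induction F rule: finite_induct)
    case empty
    then show ?case by (auto simp: module_mat_simps)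
  next
    case (insert x F)
    have "finsum (module_mat TYPE('a) nr nc) f (insert x F) = f x + finsum (module_mat TYPE('a) nr nc) f F"
      using insert.hyps insert.prems finsum_insert[of F x f] by (auto simp: module_mat_simps)
    then show ?case using insert by (auto intro!: eq_matI)
  qed
qed

lemma coeff_pf_poly: "coeff (pf_poly n A) k = (if k \<le> n then pf_coeff n A k else 0)"
  by (simp add: pf_poly_def coeff_sum)

lemma degree_pf_poly_le: "degree (pf_poly n A) \<le> n"
  by (rule degree_le) (simp add: coeff_pf_poly)

theorem theorem15:
  fixes A :: "'a :: comm_ring_1 mat" and n :: nat
  assumes "n \<ge> 1"
    and "skew_symmetric_mat (2 * n) A"
  shows "poly_at_mat (2 * n) (pf_poly n A) (A * J_mat n) =
           finsum (module_mat TYPE('a) (2 * n) (2 * n))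
             (\<lambda>k. pf_coeff n A k \<cdot>\<^sub>m ((A * J_mat n) ^\<^sub>m k)) {..n}
         \<and> finsum (module_mat TYPE('a) (2 * n) (2 * n))
             (\<lambda>k. pf_coeff n A k \<cdot>\<^sub>m ((A * J_mat n) ^\<^sub>m k)) {..n}
           = 0\<^sub>m (2 * n) (2 * n)"
proof
  let ?B = "A * J_mat n"
  have Bc: "?B ^\<^sub>m k \<in> carrier_mat (2 * n) (2 * n)" for k
    using skew_symmetric_matD(1)[OF assms(2)] by simp
  \<comment> \<open>Evaluation stops at the degree, which is at most n; any further summands up to n
    have zero coefficient.\<close>
  have "(\<Sum>k\<le>degree (pf_poly n A). (coeff (pf_poly n A) k \<cdot>\<^sub>m ?B ^\<^sub>m k) $$ (i, j)) =
      (\<Sum>k\<le>n. (pf_coeff n A k \<cdot>\<^sub>m ?B ^\<^sub>m k) $$ (i, j))" if ij: "i < 2 * n" "j < 2 * n" for i j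
  proof -
    have "(\<Sum>k\<le>degree (pf_poly n A). (coeff (pf_poly n A) k \<cdot>\<^sub>m ?B ^\<^sub>m k) $$ (i, j)) =
        (\<Sum>k\<le>n. (coeff (pf_poly n A) k \<cdot>\<^sub>m ?B ^\<^sub>m k) $$ (i, j))"
      using degree_pf_poly_le[of n A] ij carrier_matD[OF Bc]
      by (intro sum.mono_neutral_left) (auto simp: coeff_eq_0)
    then show ?thesis by (simp add: coeff_pf_poly)
  qed
  then show "poly_at_mat (2 * n) (pf_poly n A) ?B =
      finsum (module_mat TYPE('a) (2 * n) (2 * n)) (\<lambda>k. pf_coeff n A k \<cdot>\<^sub>m (?B ^\<^sub>m k)) {..n}"
    unfolding poly_at_mat_def using Bc by (subst (1 2) finsum_module_mat) (auto intro!: eq_matI)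
  have "(\<Sum>k\<le>n. (pf_coeff n A k \<cdot>\<^sub>m ?B ^\<^sub>m k) $$ (i, j)) = 0" if ij: "i < 2 * n" "j < 2 * n" for i j
  proof -
    have "(\<Sum>k\<le>n. (pf_coeff n A k \<cdot>\<^sub>m ?B ^\<^sub>m k) $$ (i, j)) =
        (\<Sum>k\<le>n. pf_coeffs n A $ (n - k) * (?B ^\<^sub>m k) $$ (i, j))"
      using ij carrier_matD[OF Bc] by (intro sum.cong refl) (simp add: pf_coeff_def)
    \<comment> \<open>In degree n the convolution pairs \<open>B^k\<close> with entry n - k of
      \<open>pf_coeffs\<close>, which is q_k; this is the lowest degree at which the bound gives
      zero.\<close>
    also have "\<dots> = fps_nth (resolvent ?B i j * pf_series n A) n"
      unfolding fps_mult_nth atMost_atLeast0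
      by (intro sum.cong refl) (simp add: resolvent_def pf_series_def mult.commute)
    also have "\<dots> = 0"
      using pf_series_resolvent[OF assms(2)] ij by (simp add: mult.commute)
    finally show ?thesis .
  qed
  then show "finsum (module_mat TYPE('a) (2 * n) (2 * n)) (\<lambda>k. pf_coeff n A k \<cdot>\<^sub>m (?B ^\<^sub>m k)) {..n}
      = 0\<^sub>m (2 * n) (2 * n)"
    using Bc by (subst finsum_module_mat) (auto intro!: eq_matI)
qed

end
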